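(* Let $\mathcal H$ be a real Hilbert space, let $A,B:\mathcal H\to 2^{\mathcal H}$ be maximal monotone, and let $C:\mathcal H\to\mathcal H$ be $\beta$-cocoercive with $\beta>0$. Let $\gamma\in(0,2\beta)$, $T:=I_{\mathcal H}-J_{\gamma B}+J_{\gamma A}\circ(2J_{\gamma B}-I_{\mathcal H}-\gamma C\circ J_{\gamma B})$, and suppose $\mathrm{Fix}\,T\neq\emptyset$. Let $\alpha=2\beta/(4\beta-\gamma)$ and let $(\lambda_j)_{j\ge0}\subseteq(0,(4\beta-\gamma)/(2\beta))=(0,1/\alpha)$ satisfy $\sum_{j=0}^\infty(1-\alpha\lambda_j)\lambda_j/\alpha=\infty$ (which is true if the sequence is bounded away from $0$ and $1/\alpha$). Let $z^0\in\mathcal H$ be arbitrary and for $k=0,1,\dots$ let $$x_B^k=J_{\gamma B}(z^k),\qquad x_A^k=J_{\gamma A}(2x_B^k-z^k-\gamma Cx_B^k),\qquad z^{k+1}=z^k+\lambda_k(x_A^k-x_B^k).$$ Then: 1. $(z^j)_{j\ge0}$ converges weakly to a fixed point of $T$; and 2. $(x_B^j)_{j\ge0}$ and $(x_A^j)_{j\ge0}$ converge weakly to an element of $\mathrm{zer}(A+B+C)$.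
   Context: $C$ is $\beta$-cocoercive if $\langle Cx-Cy,x-y\rangle\ge\beta\|Cx-Cy\|^2$ for all $x,y\in\mathcal H$. $J_S:=(I_{\mathcal H}+S)^{-1}$ is the resolvent of a maximal monotone operator $S$. $\mathrm{Fix}\,T$ is the fixed-point set of $T$, and $\mathrm{zer}(S)=\{x\in\mathcal H: 0\in Sx\}$. *)

theory Defs
  imports "HOL-Analysis.Analysis"
begin

text \<open>
  A real Hilbert space is a type of sort \<open>{real_inner, complete_space}\<close>. A set-valued operator
  on it is a function \<open>'a \<Rightarrow> 'a set\<close>, with \<open>u \<in> A x\<close> meaning that \<open>(x, u)\<close> is in the graph of \<open>A\<close>.
\<close>

definition monotone_operator :: "('a::real_inner \<Rightarrow> 'a set) \<Rightarrow> bool" where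
  "monotone_operator A \<longleftrightarrow> (\<forall>x y. \<forall>u\<in>A x. \<forall>v\<in>A y. 0 \<le> (u - v) \<bullet> (x - y))"

text \<open>The order on \<open>'a \<Rightarrow> 'a set\<close> is pointwise inclusion, that is, inclusion of graphs.\<close>

definition maximal_monotone :: "('a::real_inner \<Rightarrow> 'a set) \<Rightarrow> bool" where
  "maximal_monotone A \<longleftrightarrow>
     monotone_operator A \<and> (\<forall>A'. monotone_operator A' \<and> A \<le> A' \<longrightarrow> A' = A)"

definition cocoercive :: "real \<Rightarrow> ('a::real_inner \<Rightarrow> 'a) \<Rightarrow> bool" where
  "cocoercive \<beta> C \<longleftrightarrow> (\<forall>x y. (C x - C y) \<bullet> (x - y) \<ge> \<beta> * (norm (C x - C y))\<^sup>2)"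

definition single_valued_op :: "('a \<Rightarrow> 'a) \<Rightarrow> 'a \<Rightarrow> 'a set" where
  "single_valued_op f x = {f x}"

definition plus_op :: "('a::real_vector \<Rightarrow> 'a set) \<Rightarrow> ('a \<Rightarrow> 'a set) \<Rightarrow> 'a \<Rightarrow> 'a set" where
  "plus_op A B x = {u + v | u v. u \<in> A x \<and> v \<in> B x}"

definition scale_op :: "real \<Rightarrow> ('a::real_vector \<Rightarrow> 'a set) \<Rightarrow> 'a \<Rightarrow> 'a set" where
  "scale_op c A x = (\<lambda>u. c *\<^sub>R u) ` A x"

definition inverse_op :: "('a \<Rightarrow> 'a set) \<Rightarrow> 'a \<Rightarrow> 'a set" where
  "inverse_op A u = {x. u \<in> A x}"

definition zer :: "('a::real_vector \<Rightarrow> 'a set) \<Rightarrow> 'a set" where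
  "zer A = {x. 0 \<in> A x}"

text \<open>
  If \<open>S\<close> is maximal monotone on a Hilbert space, then \<open>(I + S)\<inverse>\<close> has exactly one value at every
  point (Minty's theorem), so \<open>resolvent S\<close> is this inverse regarded as a function. For other
  operators the description may be unspecified.
\<close>

definition resolvent :: "('a::real_vector \<Rightarrow> 'a set) \<Rightarrow> 'a \<Rightarrow> 'a" where
  "resolvent S x = (THE p. p \<in> inverse_op (plus_op (single_valued_op id) S) x)"

definition Fix :: "('a \<Rightarrow> 'a) \<Rightarrow> 'a set" where
  "Fix T = {x. T x = x}"

text \<open>
  Convergence in the weak topology of a Hilbert space, the coarsest topology making all the
  functionals \<open>\<lambda>x. x \<bullet> y\<close> continuous.
\<close>

definition weakly_converges_to :: "(nat \<Rightarrow> 'a::real_inner) \<Rightarrow> 'a \<Rightarrow> bool" where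
  "weakly_converges_to X x \<longleftrightarrow> (\<forall>y. (\<lambda>n. X n \<bullet> y) \<longlonglongrightarrow> x \<bullet> y)"

text \<open>The condition \<open>(\<Sum>j. (1 - \<alpha> \<mu>\<^sub>j) \<mu>\<^sub>j / \<alpha>) = \<infinity>\<close> on relaxation parameters \<open>\<mu>\<close>.\<close>

definition relaxation_sum_diverges :: "real \<Rightarrow> (nat \<Rightarrow> real) \<Rightarrow> bool" where
  "relaxation_sum_diverges \<alpha> \<mu> \<longleftrightarrow>
     filterlim (\<lambda>n. \<Sum>j<n. (1 - \<alpha> * \<mu> j) * \<mu> j / \<alpha>) at_top sequentially"

end

theory Submission imports Defs "HOL-Library.Diagonal_Subsequence" begin

text \<open>
  Adding the monotonicity inequalities of \<open>A\<close> and \<open>B\<close> to the cocoercivity inequality of \<open>C\<close>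
  shows that \<open>I - T\<close> is cocoercive with constant \<open>1 / (2 * \<alpha>)\<close>, and the iteration is
  \<open>z (Suc k) = z k - l k *\<^sub>R (I - T) (z k)\<close>. Such an iteration is Fejer monotone with
  residuals \<open>(I - T) (z k)\<close> tending to zero, so by Opial's argument it converges weakly to a fixed
  point \<open>w\<close>. The slack in the added inequalities also tends to zero, whence
  \<open>C (xB k) \<longlonglongrightarrow> C (J w)\<close> strongly, where \<open>J\<close> is the resolvent of \<open>scale_op \<gamma> B\<close>, and maximality
  of \<open>A\<close> forces every weak cluster point of \<open>xB\<close> to be \<open>J w\<close>. Resolvents are
  everywhere defined by Minty's theorem, which is obtained by minimizing the Fitzpatrick function
  plus half the squared norm.
\<close>

section \<open>Minimization in Hilbert spaces\<close>

text \<open>The point \<open>p\<close> below minimizes \<open>t + (norm p)\<^sup>2 / 2\<close> over \<open>E\<close>; the inequality is its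
  first-order optimality condition.\<close>

lemma epigraph_minimizer:
  fixes E :: "('a::{real_inner, complete_space} \<times> real) set"
  assumes "closed E" "convex E" "E \<noteq> {}"
    and bdd: "\<And>p t. (p, t) \<in> E \<Longrightarrow> m \<le> t + p \<bullet> p / 2"
  obtains p t where "(p, t) \<in> E" "\<And>p' t'. (p', t') \<in> E \<Longrightarrow> t + p \<bullet> p \<le> t' + p \<bullet> p'"
proof -
  define f where "f e = snd e + fst e \<bullet> fst e / 2" for e :: "'a \<times> real"
  define I where "I = Inf (f ` E)"
  have bddf: "bdd_below (f ` E)"
    using bdd by (intro bdd_belowI[of _ m]) (auto simp: f_def)
  have I_le: "I \<le> f e" if "e \<in> E" for e
    unfolding I_def using that bddf by (simp add: cInf_lower)
  have "\<exists>e\<in>E. f e < I + 1 / Suc n" for n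
    using cInf_lessD[of "f ` E" "I + 1 / Suc n"] \<open>E \<noteq> {}\<close> by (auto simp: I_def)
  then obtain e where e: "\<And>n. e n \<in> E" "\<And>n. f (e n) < I + 1 / Suc n"
    by metis
  \<comment> \<open>The value of \<open>f\<close> at the midpoint is at least \<open>I\<close>, so
    the parallelogram identity bounds the distance of two near-minimizers. This makes the first
    components of a minimizing sequence Cauchy.\<close>
  have close: "(norm (fst d - fst d'))\<^sup>2 \<le> 4 * (f d - I) + 4 * (f d' - I)"
    if "d \<in> E" "d' \<in> E" for d d'
  proof -
    have "(1/2) *\<^sub>R d + (1/2) *\<^sub>R d' \<in> E"
      using convexD[OF \<open>convex E\<close> that, of "1/2" "1/2"] by simp
    then have "I \<le> f ((1/2) *\<^sub>R d + (1/2) *\<^sub>R d')"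
      by (rule I_le)
    also have "\<dots> = (f d + f d') / 2 - (norm (fst d - fst d'))\<^sup>2 / 8"
      by (simp add: f_def power2_norm_eq_inner inner_add_left inner_add_right inner_diff_left
          inner_diff_right inner_commute field_simps)
    finally show ?thesis by argo
  qed
  have f_lim: "(\<lambda>n. f (e n)) \<longlonglongrightarrow> I"
  proof (rule tendsto_sandwich[OF _ _ tendsto_const])
    show "(\<lambda>n. I + 1 / Suc n) \<longlonglongrightarrow> I"
      using tendsto_add[OF tendsto_const LIMSEQ_inverse_real_of_nat, of I]
      by (simp add: inverse_eq_divide)
  qed (simp_all add: e I_le less_imp_le del: of_nat_Suc)
  have "Cauchy (\<lambda>n. fst (e n))"
  proof (rule metric_CauchyI)
    fix \<epsilon> :: real assume "\<epsilon> > 0"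
    then have "\<forall>\<^sub>F n in sequentially. f (e n) < I + \<epsilon>\<^sup>2 / 8"
      using order_tendstoD(2)[OF f_lim, of "I + \<epsilon>\<^sup>2 / 8"] by simp
    then obtain M where M: "f (e n) < I + \<epsilon>\<^sup>2 / 8" if "n \<ge> M" for n
      by (auto simp: eventually_sequentially)
    have "dist (fst (e i)) (fst (e j)) < \<epsilon>" if "i \<ge> M" "j \<ge> M" for i j
    proof -
      have "(norm (fst (e i) - fst (e j)))\<^sup>2 < \<epsilon>\<^sup>2"
        using close[OF e(1) e(1), of i j] M[OF that(1)] M[OF that(2)] by simp
      then show ?thesis
        using \<open>\<epsilon> > 0\<close> by (simp add: dist_norm power2_less_imp_less)
    qed
    then show "\<exists>M. \<forall>i\<ge>M. \<forall>j\<ge>M. dist (fst (e i)) (fst (e j)) < \<epsilon>"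
      by blast
  qed
  then obtain p where p: "(\<lambda>n. fst (e n)) \<longlonglongrightarrow> p"
    by (auto simp: Cauchy_convergent_iff convergent_def)
  define t where "t = I - p \<bullet> p / 2"
  have "(\<lambda>n. f (e n) - fst (e n) \<bullet> fst (e n) / 2) \<longlonglongrightarrow> t"
    unfolding t_def by (intro tendsto_intros f_lim p) simp
  then have "(\<lambda>n. snd (e n)) \<longlonglongrightarrow> t"
    by (simp add: f_def)
  from tendsto_Pair[OF p this] have "e \<longlonglongrightarrow> (p, t)"
    by simp
  with \<open>closed E\<close> e(1) have pt: "(p, t) \<in> E"
    by (meson closed_sequentially)
  have "t + p \<bullet> p \<le> t' + p \<bullet> p'" if E': "(p', t') \<in> E" for p' t'
  proof -
    \<comment> \<open>Minimality is tested along the segment from \<open>(p, t)\<close> to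
      \<open>(p', t')\<close> and divided by \<open>s\<close>; letting \<open>s\<close> tend to 0
      removes the quadratic term.\<close>
    have ineq: "0 \<le> (t' - t) + p \<bullet> (p' - p) + s * ((p' - p) \<bullet> (p' - p) / 2)"
      if s: "0 < s" "s < 1" for s :: real
    proof -
      have "(1 - s) *\<^sub>R (p, t) + s *\<^sub>R (p', t') \<in> E"
        using convexD[OF \<open>convex E\<close> pt E', of "1 - s" s] s by simp
      then have "I \<le> f ((1 - s) *\<^sub>R (p, t) + s *\<^sub>R (p', t'))"
        by (rule I_le)
      also have "\<dots> = I + s * ((t' - t) + p \<bullet> (p' - p) + s * ((p' - p) \<bullet> (p' - p) / 2))"
        by (simp add: f_def t_def algebra_simps inner_commute power2_eq_square add_divide_distrib
            diff_divide_distrib)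
      finally show ?thesis
        using s by (simp add: zero_le_mult_iff)
    qed
    have "((\<lambda>s. (t' - t) + p \<bullet> (p' - p) + s * ((p' - p) \<bullet> (p' - p) / 2))
        \<longlongrightarrow> (t' - t) + p \<bullet> (p' - p) + 0 * ((p' - p) \<bullet> (p' - p) / 2)) (at_right 0)"
      by (intro tendsto_intros)
    moreover have "\<forall>\<^sub>F s in at_right (0::real).
        0 \<le> (t' - t) + p \<bullet> (p' - p) + s * ((p' - p) \<bullet> (p' - p) / 2)"
      using eventually_at_right_field[of _ "0::real"] ineq zero_less_one by blast
    ultimately have "0 \<le> (t' - t) + p \<bullet> (p' - p) + 0 * ((p' - p) \<bullet> (p' - p) / 2)"
      by (rule tendsto_lowerbound) simp
    then show ?thesis by (simp add: algebra_simps)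
  qed
  with pt that show thesis by blast
qed

text \<open>If \<open>g y\<close> were nonzero, a multiple of \<open>y\<close> would have the value
  \<open>c - 1\<close>, below the bound. This turns the optimality inequality of
  \<open>epigraph_minimizer\<close> into an equation on a subspace.\<close>

lemma linear_bounded_below_eq_0:
  fixes g :: "'a::real_vector \<Rightarrow> real"
  assumes "linear g" "subspace V" "y \<in> V" and bdd: "\<And>y. y \<in> V \<Longrightarrow> c \<le> g y"
  shows "g y = 0"
proof (rule ccontr)
  assume "g y \<noteq> 0"
  moreover have "c \<le> g (((c - 1) / g y) *\<^sub>R y)"
    by (intro bdd subspace_scale assms)
  ultimately show False
    using \<open>linear g\<close> by (simp add: linear_cmul)
qed

text \<open>The representing vector minimizes \<open>p \<bullet> p / 2 - L p\<close>, so the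
  minimization is over the graph of \<open>- L\<close>. Its optimality condition bounds the linear
  map \<open>p \<bullet> y - L y\<close> from below, which forces it to vanish.\<close>

lemma riesz_representation:
  fixes L :: "'a::{real_inner, complete_space} \<Rightarrow> real"
  assumes "bounded_linear L"
  obtains p where "\<And>y. L y = p \<bullet> y"
proof -
  interpret bounded_linear L by fact
  obtain K where K: "\<And>x. \<bar>L x\<bar> \<le> norm x * K"
    using bounded by auto
  have "closed {e :: 'a \<times> real. snd e = - L (fst e)}"
    by (intro closed_Collect_eq continuous_intros linear_continuous_on_compose
        bounded_linear.continuous_on[OF assms])
  moreover have "convex {e :: 'a \<times> real. snd e = - L (fst e)}"
    by (auto simp: convex_def add scaleR algebra_simps)
  \<comment> \<open>The lower bound comes from \<open>L p \<le> K * norm p\<close> by completing the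
    square.\<close>
  moreover have "- K\<^sup>2 / 2 \<le> t + p \<bullet> p / 2" if "(p, t) \<in> {e. snd e = - L (fst e)}" for p t
  proof -
    have "0 \<le> (norm p - K)\<^sup>2" by simp
    then show ?thesis
      using K[of p] that by (simp add: power2_eq_square algebra_simps dot_square_norm)
  qed
  moreover have "{e :: 'a \<times> real. snd e = - L (fst e)} \<noteq> {}"
    by (auto intro!: exI[of _ 0])
  ultimately obtain p t where *: "(p, t) \<in> {e. snd e = - L (fst e)}"
    "\<And>p' t'. (p', t') \<in> {e. snd e = - L (fst e)} \<Longrightarrow> t + p \<bullet> p \<le> t' + p \<bullet> p'"
    using epigraph_minimizer[of "{e. snd e = - L (fst e)}" "- K\<^sup>2 / 2"] by blast
  have "p \<bullet> y - L y = 0" for y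
  proof (rule linear_bounded_below_eq_0[where V = UNIV and g = "\<lambda>y. p \<bullet> y - L y"])
    show "linear (\<lambda>y. p \<bullet> y - L y)"
      by (intro linear_compose_sub linear_axioms bounded_linear.linear bounded_linear_inner_right)
  qed (use *(2)[of _ "- L _"] in auto)
  then show thesis
    by (intro that[of p]) simp
qed

text \<open>The vector \<open>q\<close> has least norm in the affine space \<open>y - V\<close>; the
  real component is pinned to 0 so that only the norm is minimized. Optimality makes
  \<open>q \<bullet> v\<close> nonnegative on the subspace \<open>V\<close>, hence zero.\<close>

lemma orthogonal_decomposition:
  fixes V :: "'a::{real_inner, complete_space} set"
  assumes "closed V" "subspace V"
  obtains q where "y - q \<in> V" "\<And>v. v \<in> V \<Longrightarrow> q \<bullet> v = 0"
proof -
  let ?E = "{e :: 'a \<times> real. y - fst e \<in> V \<and> snd e = 0}"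
  have "closed ?E"
    by (intro closed_Collect_conj closed_Collect_eq continuous_intros
        closed_vimage[OF \<open>closed V\<close>, unfolded vimage_def])
  moreover have "convex ?E"
  proof (rule convexI)
    fix e e' :: "'a \<times> real" and u v :: real
    assume e: "e \<in> ?E" "e' \<in> ?E" and uv: "0 \<le> u" "0 \<le> v" "u + v = 1"
    have "u *\<^sub>R (y - fst e) + v *\<^sub>R (y - fst e') \<in> V"
      using e \<open>subspace V\<close> by (simp add: subspace_add subspace_scale)
    also have "u *\<^sub>R (y - fst e) + v *\<^sub>R (y - fst e') = (u + v) *\<^sub>R y - fst (u *\<^sub>R e + v *\<^sub>R e')"
      by (simp add: algebra_simps)
    finally show "u *\<^sub>R e + v *\<^sub>R e' \<in> ?E"
      using e uv by simp
  qed
  moreover have "?E \<noteq> {}"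
    using subspace_0[OF \<open>subspace V\<close>] by (auto intro!: exI[of _ y])
  ultimately obtain q t where *: "(q, t) \<in> ?E"
    "\<And>p' t'. (p', t') \<in> ?E \<Longrightarrow> t + q \<bullet> q \<le> t' + q \<bullet> p'"
    by (rule epigraph_minimizer[where m = 0]) auto
  have "q \<bullet> v = 0" if "v \<in> V" for v
  proof (rule linear_bounded_below_eq_0[where g = "\<lambda>v. q \<bullet> v"])
    show "linear (\<lambda>v. q \<bullet> v)"
      by (intro bounded_linear.linear bounded_linear_inner_right)
    fix v assume "v \<in> V"
    then have "y - (q + v) \<in> V"
      using *(1) subspace_diff[OF \<open>subspace V\<close>, of "y - q" v] by (simp add: algebra_simps)
    then show "0 \<le> q \<bullet> v"
      using *(1) *(2)[of "q + v" 0] by (simp add: inner_add_right)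
  qed (use that \<open>subspace V\<close> in auto)
  with * that show thesis by auto
qed


section \<open>Weak convergence\<close>

lemma weakly_converges_toD:
  "weakly_converges_to X x \<Longrightarrow> (\<lambda>n. X n \<bullet> y) \<longlonglongrightarrow> x \<bullet> y"
  by (simp add: weakly_converges_to_def)

lemma weakly_converges_to_subseq:
  "weakly_converges_to X x \<Longrightarrow> strict_mono r \<Longrightarrow> weakly_converges_to (X \<circ> r) x"
  using LIMSEQ_subseq_LIMSEQ by (fastforce simp: weakly_converges_to_def comp_def)

lemma weakly_converges_to_add:
  "weakly_converges_to X x \<Longrightarrow> weakly_converges_to Y y \<Longrightarrow>
    weakly_converges_to (\<lambda>n. X n + Y n) (x + y)"
  by (auto simp: weakly_converges_to_def inner_add_left intro!: tendsto_add)

lemma tendsto_imp_weakly_converges_to: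
  "X \<longlonglongrightarrow> x \<Longrightarrow> weakly_converges_to X x"
  by (auto simp: weakly_converges_to_def intro!: tendsto_intros)

lemma weakly_converges_to_diff:
  "weakly_converges_to X x \<Longrightarrow> weakly_converges_to Y y \<Longrightarrow>
    weakly_converges_to (\<lambda>n. X n - Y n) (x - y)"
  by (auto simp: weakly_converges_to_def inner_diff_left intro!: tendsto_diff)

lemma bounded_diagonal_subseq:
  fixes a :: "nat \<Rightarrow> nat \<Rightarrow> real"
  assumes "\<And>m. bounded (range (\<lambda>n. a n m))"
  obtains r where "strict_mono (r :: nat \<Rightarrow> nat)" "\<And>m. convergent (\<lambda>n. a (r n) m)"
proof -
  interpret subseqs "\<lambda>m s. convergent (\<lambda>n. a (s n) m)"
  proof
    fix m :: nat and s :: "nat \<Rightarrow> nat"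
    have "bounded (range (\<lambda>n. a (s n) m))"
      by (rule bounded_subset[OF assms[of m]]) auto
    then obtain l r where "strict_mono r" "((\<lambda>n. a (s n) m) \<circ> r) \<longlonglongrightarrow> l"
      using bounded_imp_convergent_subsequence by blast
    then show "\<exists>r. strict_mono r \<and> convergent (\<lambda>n. a ((s \<circ> r) n) m)"
      by (auto simp: convergent_def comp_def)
  qed
  have "convergent (\<lambda>n. a (diagseq n) m)" for m
  proof -
    \<comment> \<open>The diagonal sequence is a subsequence of the extraction that settles column
      \<open>m\<close> only from index \<open>Suc m\<close> on; the finite shift does not affect
      convergence.\<close>
    have "convergent (\<lambda>n. a ((diagseq \<circ> (+) (Suc m)) n) m)"
    proof (rule diagseq_holds)
      fix r s :: "nat \<Rightarrow> nat" and k
      assume "strict_mono r" "convergent (\<lambda>n. a (s n) k)"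
      then show "convergent (\<lambda>n. a ((s \<circ> r) n) k)"
        using convergent_subseq_convergent by (force simp: comp_def)
    qed
    then show ?thesis
      using convergent_ignore_initial_segment[of "\<lambda>n. a (diagseq n) m" "Suc m"]
      by (simp add: comp_def add.commute)
  qed
  with subseq_diagseq that show thesis by blast
qed

text \<open>Separability is avoided by extracting a subsequence whose inner products with the
  countably many vectors \<open>X m\<close> converge. The test vectors with convergent inner
  products form a closed subspace \<open>V\<close> containing every \<open>X m\<close>. A vector
  orthogonal to \<open>V\<close> has zero inner products with the sequence and so lies in
  \<open>V\<close> itself; hence \<open>V\<close> is everything, and Riesz represents the limit
  functional.\<close>

lemma bounded_imp_weakly_convergent_subseq:
  fixes X :: "nat \<Rightarrow> 'a::{real_inner, complete_space}"
  assumes "bounded (range X)"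
  obtains x r where "strict_mono (r :: nat \<Rightarrow> nat)" "weakly_converges_to (X \<circ> r) x"
proof -
  obtain M where M: "\<And>n. norm (X n) \<le> M"
    using assms by (auto simp: bounded_iff)
  have "0 \<le> M"
    using M[of 0] norm_ge_zero order_trans by blast
  have XM: "\<bar>X n \<bullet> y\<bar> \<le> M * norm y" for n y
    by (rule order_trans[OF Cauchy_Schwarz_ineq2]) (simp add: M mult_right_mono)
  then have "bounded (range (\<lambda>n. X n \<bullet> X m))" for m
    by (auto simp: bounded_iff intro!: exI[of _ "M * norm (X m)"])
  then obtain r :: "nat \<Rightarrow> nat" where r: "strict_mono r" "\<And>m. convergent (\<lambda>n. X (r n) \<bullet> X m)"
    using bounded_diagonal_subseq[of "\<lambda>n m. X n \<bullet> X m"] by blast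
  define V where "V = {y. convergent (\<lambda>n. X (r n) \<bullet> y)}"
  have "subspace V"
    by (auto simp: V_def subspace_def inner_add_right convergent_const
        intro: convergent_add convergent_mult)
  moreover have "closed V"
    unfolding closed_sequential_limits
  proof (intro allI impI, elim conjE)
    fix v y assume v: "\<forall>j. v j \<in> V" "v \<longlonglongrightarrow> y"
    have "Cauchy (\<lambda>n. X (r n) \<bullet> y)"
    proof (rule metric_CauchyI)
      fix \<epsilon> :: real assume "\<epsilon> > 0"
      \<comment> \<open>This makes \<open>M * \<delta>\<close> strictly less than a third of
        \<open>\<epsilon>\<close>, also when \<open>M = 0\<close>. Replacing \<open>y\<close> by
        \<open>v j\<close> then costs less than a third, uniformly in the index of
        \<open>X\<close>.\<close>
      define \<delta> where "\<delta> = \<epsilon> / (3 * (M + 1))"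
      have "0 < \<delta>"
        using \<open>\<epsilon> > 0\<close> \<open>0 \<le> M\<close> by (simp add: \<delta>_def)
      then obtain j where j: "norm (v j - y) < \<delta>"
        using metric_LIMSEQ_D[OF v(2), of \<delta>] by (auto simp: dist_norm)
      have near: "\<bar>X n \<bullet> (v j - y)\<bar> < \<epsilon> / 3" for n
      proof -
        have "\<bar>X n \<bullet> (v j - y)\<bar> \<le> M * \<delta>"
          using XM[of n "v j - y"] mult_left_mono[OF less_imp_le[OF j] \<open>0 \<le> M\<close>] by linarith
        also have "\<dots> < (M + 1) * \<delta>"
          using \<open>0 < \<delta>\<close> by (simp add: algebra_simps)
        also have "\<dots> = \<epsilon> / 3"
          using \<open>0 \<le> M\<close> by (simp add: \<delta>_def divide_simps)
        finally show ?thesis .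
      qed
      have "Cauchy (\<lambda>n. X (r n) \<bullet> v j)"
        using v(1) by (simp add: V_def convergent_Cauchy)
      then obtain K where K: "\<And>m n. m \<ge> K \<Longrightarrow> n \<ge> K \<Longrightarrow> \<bar>X (r m) \<bullet> v j - X (r n) \<bullet> v j\<bar> < \<epsilon> / 3"
        using metric_CauchyD[of "\<lambda>n. X (r n) \<bullet> v j" "\<epsilon> / 3"] \<open>\<epsilon> > 0\<close>
        by (auto simp: dist_real_def)
      have "dist (X (r m) \<bullet> y) (X (r n) \<bullet> y) < \<epsilon>" if "m \<ge> K" "n \<ge> K" for m n
        using near[of "r m"] near[of "r n"] K[OF that]
        unfolding dist_real_def inner_diff_right by argo
      then show "\<exists>K. \<forall>m\<ge>K. \<forall>n\<ge>K. dist (X (r m) \<bullet> y) (X (r n) \<bullet> y) < \<epsilon>"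
        by blast
    qed
    then show "y \<in> V"
      by (simp add: V_def Cauchy_convergent)
  qed
  ultimately have all_V: "y \<in> V" for y
  proof -
    obtain q where q: "y - q \<in> V" "\<And>v. v \<in> V \<Longrightarrow> q \<bullet> v = 0"
      using orthogonal_decomposition[OF \<open>closed V\<close> \<open>subspace V\<close>] by blast
    have "X (r n) \<bullet> q = 0" for n
      using q(2)[of "X (r n)"] r(2) by (simp add: V_def inner_commute)
    then have "q \<in> V" by (simp add: V_def convergent_const)
    with q(1) show ?thesis
      using subspace_add[OF \<open>subspace V\<close>] by fastforce
  qed
  then obtain L where L: "\<And>y. (\<lambda>n. X (r n) \<bullet> y) \<longlonglongrightarrow> L y"
    unfolding V_def convergent_def mem_Collect_eq by metis
  have "bounded_linear L"
  proof (rule bounded_linear_intro)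
    show "L (y + y') = L y + L y'" for y y'
      using tendsto_add[OF L[of y] L[of y']] L[of "y + y'"]
      by (simp add: inner_add_right LIMSEQ_unique)
    show "L (c *\<^sub>R y) = c *\<^sub>R L y" for c y
      using tendsto_mult_left[OF L[of y], of c] L[of "c *\<^sub>R y"] by (simp add: LIMSEQ_unique)
    show "norm (L y) \<le> norm y * M" for y
      using tendsto_norm[OF L[of y]]
      by (rule tendsto_upperbound) (auto simp: XM mult.commute)
  qed
  then obtain x where "\<And>y. L y = x \<bullet> y"
    using riesz_representation by blast
  with L have "weakly_converges_to (X \<circ> r) x"
    by (simp add: weakly_converges_to_def comp_def)
  with r(1) that show thesis by blast
qed

text \<open>If convergence failed for some \<open>y\<close>, infinitely many terms would stay
  outside a neighbourhood of \<open>x \<bullet> y\<close>. These terms have a weakly convergent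
  subsequence, whose limit must be \<open>x\<close>, a contradiction.\<close>

lemma bounded_weakly_converges_toI:
  fixes X :: "nat \<Rightarrow> 'a::{real_inner, complete_space}"
  assumes "bounded (range X)"
    and cluster: "\<And>r x'. strict_mono (r :: nat \<Rightarrow> nat) \<Longrightarrow> weakly_converges_to (X \<circ> r) x' \<Longrightarrow> x' = x"
  shows "weakly_converges_to X x"
  unfolding weakly_converges_to_def
proof (rule allI, rule ccontr)
  fix y assume "\<not> (\<lambda>n. X n \<bullet> y) \<longlonglongrightarrow> x \<bullet> y"
  then obtain U where U: "open U" "x \<bullet> y \<in> U" "\<exists>\<^sub>F n in sequentially. X n \<bullet> y \<notin> U"
    by (auto simp: tendsto_def not_eventually)
  from U(3) have inf: "infinite {n. X n \<bullet> y \<notin> U}"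
    by (simp add: frequently_cofinite cofinite_eq_sequentially[symmetric])
  define s where "s = enumerate {n. X n \<bullet> y \<notin> U}"
  have s: "strict_mono s" "\<And>n. X (s n) \<bullet> y \<notin> U"
    using strict_mono_enumerate[OF inf] enumerate_in_set[OF inf] by (auto simp: s_def)
  have "bounded (range (X \<circ> s))"
    by (rule bounded_subset[OF \<open>bounded (range X)\<close>]) auto
  then obtain r x' where r: "strict_mono r" and x': "weakly_converges_to (X \<circ> s \<circ> r) x'"
    by (rule bounded_imp_weakly_convergent_subseq)
  have "x' = x"
    using x' by (intro cluster[of "s \<circ> r"]) (simp_all add: comp_assoc strict_mono_o s r)
  with x' have "(\<lambda>n. X (s (r n)) \<bullet> y) \<longlonglongrightarrow> x \<bullet> y"
    by (simp add: weakly_converges_to_def comp_def)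
  then have "\<forall>\<^sub>F n in sequentially. X (s (r n)) \<bullet> y \<in> U"
    using U topological_tendstoD by blast
  then show False
    using s(2) by simp
qed

lemma tendsto_inner_bounded_zero:
  fixes X Y :: "nat \<Rightarrow> 'a::real_inner"
  assumes "bounded (range X)" "Y \<longlonglongrightarrow> 0"
  shows "(\<lambda>n. X n \<bullet> Y n) \<longlonglongrightarrow> 0"
proof -
  obtain M where M: "\<And>n. norm (X n) \<le> M"
    using assms(1) by (auto simp: bounded_iff)
  show ?thesis
  proof (rule Lim_null_comparison)
    show "\<forall>\<^sub>F n in sequentially. norm (X n \<bullet> Y n) \<le> M * norm (Y n)"
      by (intro always_eventually allI)
        (auto intro!: order_trans[OF Cauchy_Schwarz_ineq2] mult_right_mono M)
    show "(\<lambda>n. M * norm (Y n)) \<longlonglongrightarrow> 0"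
      using assms(2) by (intro tendsto_mult_right_zero tendsto_norm_zero)
  qed
qed


section \<open>Maximal monotone operators and Minty's theorem\<close>

text \<open>A pair monotonically related to the whole graph can be adjoined without losing
  monotonicity, so maximality puts it in the graph already. This pointwise form is how maximality
  enters the later arguments.\<close>

lemma maximal_monotone_iff:
  "maximal_monotone S \<longleftrightarrow> (\<forall>x u. u \<in> S x \<longleftrightarrow> (\<forall>y. \<forall>v\<in>S y. 0 \<le> (u - v) \<bullet> (x - y)))"
proof (rule iffI, intro allI)
  fix x u
  assume S: "maximal_monotone S"
  then have mono: "monotone_operator S"
    and max: "\<And>S'. monotone_operator S' \<Longrightarrow> S \<le> S' \<Longrightarrow> S' = S"
    by (auto simp: maximal_monotone_def)
  show "u \<in> S x \<longleftrightarrow> (\<forall>y. \<forall>v\<in>S y. 0 \<le> (u - v) \<bullet> (x - y))"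
  proof
    assume rel: "\<forall>y. \<forall>v\<in>S y. 0 \<le> (u - v) \<bullet> (x - y)"
    have rel': "\<And>y v. v \<in> S y \<Longrightarrow> 0 \<le> (v - u) \<bullet> (y - x)"
      using rel by (metis inner_minus_left inner_minus_right minus_diff_eq minus_minus)
    have "monotone_operator (S(x := insert u (S x)))"
      using mono rel rel' by (auto simp: monotone_operator_def)
    then have "S(x := insert u (S x)) = S"
      by (rule max) (auto simp: le_fun_def)
    then show "u \<in> S x"
      by (metis fun_upd_same insertI1)
  qed (use mono in \<open>auto simp: monotone_operator_def\<close>)
next
  assume *: "\<forall>x u. u \<in> S x \<longleftrightarrow> (\<forall>y. \<forall>v\<in>S y. 0 \<le> (u - v) \<bullet> (x - y))"
  show "maximal_monotone S"
    unfolding maximal_monotone_def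
  proof (intro conjI allI impI)
    show "monotone_operator S"
      using * unfolding monotone_operator_def by blast
    fix S' assume S': "monotone_operator S' \<and> S \<le> S'"
    have "S' x \<subseteq> S x" for x
      using S' * unfolding monotone_operator_def le_fun_def by (meson subsetD subsetI)
    with S' show "S' = S"
      by (intro antisym) (auto simp: le_fun_def)
  qed
qed

lemma maximal_monotone_memI:
  "maximal_monotone S \<Longrightarrow> (\<And>y v. v \<in> S y \<Longrightarrow> 0 \<le> (u - v) \<bullet> (x - y)) \<Longrightarrow> u \<in> S x"
  unfolding maximal_monotone_iff by blast

lemma maximal_monotoneD:
  "maximal_monotone S \<Longrightarrow> u \<in> S x \<Longrightarrow> v \<in> S y \<Longrightarrow> 0 \<le> (u - v) \<bullet> (x - y)"
  unfolding maximal_monotone_iff by blast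

lemma mem_scale_op_iff: "c \<noteq> 0 \<Longrightarrow> u \<in> scale_op c S x \<longleftrightarrow> u /\<^sub>R c \<in> S x"
  by (force simp: scale_op_def image_iff)

lemma maximal_monotone_scale_op:
  fixes S :: "'a::real_inner \<Rightarrow> 'a set"
  assumes "maximal_monotone S" "0 < c"
  shows "maximal_monotone (scale_op c S)"
  unfolding maximal_monotone_iff
proof (intro allI)
  fix x u :: 'a
  have eq: "(u - c *\<^sub>R v) \<bullet> (x - y) = c * ((u /\<^sub>R c - v) \<bullet> (x - y))" for v y
    using \<open>0 < c\<close> by (simp add: inner_diff_left right_diff_distrib)
  have "u \<in> scale_op c S x \<longleftrightarrow> u /\<^sub>R c \<in> S x"
    using \<open>0 < c\<close> by (simp add: mem_scale_op_iff)
  also have "\<dots> \<longleftrightarrow> (\<forall>y. \<forall>v\<in>S y. 0 \<le> (u /\<^sub>R c - v) \<bullet> (x - y))"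
    using \<open>maximal_monotone S\<close> unfolding maximal_monotone_iff by blast
  also have "\<dots> \<longleftrightarrow> (\<forall>y. \<forall>v\<in>scale_op c S y. 0 \<le> (u - v) \<bullet> (x - y))"
    unfolding scale_op_def ball_simps eq using \<open>0 < c\<close> by (simp add: zero_le_mult_iff)
  finally show "u \<in> scale_op c S x \<longleftrightarrow> (\<forall>y. \<forall>v\<in>scale_op c S y. 0 \<le> (u - v) \<bullet> (x - y))" .
qed

lemma maximal_monotone_translate:
  assumes "maximal_monotone S"
  shows "maximal_monotone (\<lambda>x. {u. u + c \<in> S x})"
proof -
  have "(\<forall>y. \<forall>v\<in>{v. v + c \<in> S y}. 0 \<le> (u - v) \<bullet> (x - y)) \<longleftrightarrow>
      (\<forall>y. \<forall>v\<in>S y. 0 \<le> (u + c - v) \<bullet> (x - y))" for x u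
  proof (intro iffI allI ballI)
    fix y v
    assume "\<forall>y. \<forall>v\<in>{v. v + c \<in> S y}. 0 \<le> (u - v) \<bullet> (x - y)" and "v \<in> S y"
    then have "0 \<le> (u - (v - c)) \<bullet> (x - y)"
      by simp
    then show "0 \<le> (u + c - v) \<bullet> (x - y)"
      by (simp add: algebra_simps)
  next
    fix y v
    assume "\<forall>y. \<forall>v\<in>S y. 0 \<le> (u + c - v) \<bullet> (x - y)" and "v \<in> {v. v + c \<in> S y}"
    then have "0 \<le> (u + c - (v + c)) \<bullet> (x - y)"
      by blast
    then show "0 \<le> (u - v) \<bullet> (x - y)"
      by simp
  qed
  moreover have "u + c \<in> S x \<longleftrightarrow> (\<forall>y. \<forall>v\<in>S y. 0 \<le> (u + c - v) \<bullet> (x - y))" for x u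
    using assms unfolding maximal_monotone_iff by blast
  ultimately show ?thesis
    unfolding maximal_monotone_iff mem_Collect_eq by blast
qed

text \<open>
  The epigraph below is that of the Fitzpatrick function of \<open>S\<close>, which lies above the duality
  pairing by maximality and agrees with it on the graph of \<open>S\<close> by monotonicity. If \<open>(x, u)\<close>
  minimizes it after adding \<open>(norm (x, u))\<^sup>2 / 2\<close>, then the optimality condition says
  that \<open>(- u, - x)\<close> is monotonically related to the graph of \<open>S\<close>, with \<open>u = - x\<close>.
\<close>

lemma maximal_monotone_zero_in_range:
  fixes S :: "'a::{real_inner, complete_space} \<Rightarrow> 'a set"
  assumes S: "maximal_monotone S"
  obtains x where "- x \<in> S x"
proof -
  let ?E = "{e :: ('a \<times> 'a) \<times> real. \<forall>y. \<forall>v\<in>S y.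
    fst (fst e) \<bullet> v + y \<bullet> snd (fst e) - y \<bullet> v \<le> snd e}"
  have "closed ?E"
    unfolding Ball_def
    by (intro closed_Collect_all closed_Collect_imp closed_Collect_le open_Collect_const continuous_intros)
  moreover have "convex ?E"
  proof (rule convexI)
    fix e e' :: "('a \<times> 'a) \<times> real" and a b :: real
    assume e: "e \<in> ?E" "e' \<in> ?E" and ab: "0 \<le> a" "0 \<le> b" "a + b = 1"
    show "a *\<^sub>R e + b *\<^sub>R e' \<in> ?E"
    proof (intro CollectI allI ballI)
      fix y v assume v: "v \<in> S y"
      have "a * (fst (fst e) \<bullet> v + y \<bullet> snd (fst e) - y \<bullet> v)
          + b * (fst (fst e') \<bullet> v + y \<bullet> snd (fst e') - y \<bullet> v) \<le> a * snd e + b * snd e'"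
        using e v ab by (intro add_mono mult_left_mono) auto
      moreover have "a * (y \<bullet> v) + b * (y \<bullet> v) = y \<bullet> v"
        using ab by (simp flip: distrib_right)
      ultimately show "fst (fst (a *\<^sub>R e + b *\<^sub>R e')) \<bullet> v + y \<bullet> snd (fst (a *\<^sub>R e + b *\<^sub>R e'))
          - y \<bullet> v \<le> snd (a *\<^sub>R e + b *\<^sub>R e')"
        by (simp add: inner_add_left inner_add_right right_diff_distrib distrib_left)
    qed
  qed
  \<comment> \<open>Otherwise \<open>(x, u)\<close> would be strictly related to every point of the
    graph, hence belong to it by maximality, and then be strictly related to itself.\<close>
  moreover have pairing_le: "x \<bullet> u \<le> t" if e: "((x, u), t) \<in> ?E" for x u t
  proof (rule ccontr)
    assume "\<not> x \<bullet> u \<le> t"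
    then have less: "0 < (u - v) \<bullet> (x - y)" if "v \<in> S y" for y v
      using e that by (fastforce simp: inner_diff_left inner_diff_right inner_commute)
    then have "u \<in> S x"
      by (intro maximal_monotone_memI[OF S] less_imp_le)
    from less[OF this] show False by simp
  qed
  have graph: "((y, v), y \<bullet> v) \<in> ?E" if v: "v \<in> S y" for y v
  proof (intro CollectI allI ballI)
    fix y' v' assume "v' \<in> S y'"
    then show "fst (fst ((y, v), y \<bullet> v)) \<bullet> v' + y' \<bullet> snd (fst ((y, v), y \<bullet> v)) - y' \<bullet> v'
        \<le> snd ((y, v), y \<bullet> v)"
      using maximal_monotoneD[OF S v, of v' y']
      by (simp add: inner_diff_left inner_diff_right inner_commute)
  qed
  \<comment> \<open>With an empty graph every pair would be vacuously related to it and so belong to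
    it.\<close>
  obtain y v where "v \<in> S y"
    using maximal_monotone_memI[OF S] by (metis empty_iff)
  then have "?E \<noteq> {}"
    using graph by blast
  moreover have "0 \<le> t + p \<bullet> p / 2" if "(p, t) \<in> ?E" for p t
  proof -
    have "0 \<le> (fst p + snd p) \<bullet> (fst p + snd p)" by simp
    moreover have "fst p \<bullet> snd p \<le> t"
      using pairing_le[of "fst p" "snd p" t] that by simp
    ultimately show ?thesis
      by (simp add: inner_prod_def inner_add_left inner_add_right inner_commute field_simps)
  qed
  ultimately obtain p t where p: "(p, t) \<in> ?E"
    "\<And>p' t'. (p', t') \<in> ?E \<Longrightarrow> t + p \<bullet> p \<le> t' + p \<bullet> p'"
    using epigraph_minimizer[of ?E 0] by blast
  obtain x u where xu: "p = (x, u)" by fastforce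
  \<comment> \<open>The optimality condition is tested at the graph point
    \<open>((y, v), y \<bullet> v)\<close>, and \<open>x \<bullet> u \<le> t\<close> is used to
    complete the square.\<close>
  have key: "(x + u) \<bullet> (x + u) \<le> (- x - v) \<bullet> (- u - y)" if "v \<in> S y" for y v
    using p(2)[OF graph[OF that]] pairing_le[of x u t] p(1)
    by (simp add: xu inner_prod_def inner_add_left inner_add_right inner_diff_left
        inner_diff_right inner_commute)
  have mem: "- x \<in> S (- u)"
    by (rule maximal_monotone_memI[OF S]) (use key inner_ge_zero order_trans in blast)
  \<comment> \<open>Taking the point just found as \<open>(y, v)\<close> makes the right-hand side
    of \<open>key\<close> zero.\<close>
  from key[OF this] have "(x + u) \<bullet> (x + u) = 0"
    using inner_ge_zero[of "x + u"] by simp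
  then have "x + u = 0" by simp
  then have "- u = x" by (simp add: add_eq_0_iff2)
  with mem show thesis by (intro that[of x]) simp
qed

text \<open>Translating the values of \<open>S\<close> by \<open>x\<close> reduces the inclusion to
  \<open>maximal_monotone_zero_in_range\<close>.\<close>

lemma minty:
  fixes S :: "'a::{real_inner, complete_space} \<Rightarrow> 'a set"
  assumes "maximal_monotone S"
  obtains p where "x - p \<in> S p"
  using maximal_monotone_zero_in_range[OF maximal_monotone_translate[OF assms, of x]] that by auto

text \<open>Existence is Minty's theorem, and monotonicity applied to two solutions shows that they
  agree. The definite description is therefore legitimate.\<close>

lemma resolvent_mem:
  fixes S :: "'a::{real_inner, complete_space} \<Rightarrow> 'a set"
  assumes S: "maximal_monotone S"
  shows "x - resolvent S x \<in> S (resolvent S x)"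
proof -
  have iff: "p \<in> inverse_op (plus_op (single_valued_op id) S) x \<longleftrightarrow> x - p \<in> S p" for p
    by (force simp: inverse_op_def plus_op_def single_valued_op_def)
  obtain p where p: "x - p \<in> S p"
    using minty[OF S] by blast
  have "q = p" if "x - q \<in> S q" for q
  proof -
    have "0 \<le> ((x - q) - (x - p)) \<bullet> (q - p)"
      using maximal_monotoneD[OF S that p] .
    also have "\<dots> = - ((q - p) \<bullet> (q - p))"
      by (simp add: inner_diff_left inner_diff_right)
    finally have "(q - p) \<bullet> (q - p) = 0"
      using inner_ge_zero[of "q - p"] by linarith
    then show ?thesis by simp
  qed
  with p have "resolvent S x = p"
    unfolding resolvent_def iff by (intro the_equality)
  with p show ?thesis by simp
qed


section \<open>The Krasnosel'skii--Mann iteration\<close>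

text \<open>In the cocoercivity inequality between \<open>Z n\<close> and \<open>w\<close> the
  right-hand side tends to 0: one term pairs a strongly null sequence with a bounded one, the other
  a fixed vector with a weakly null sequence. The left-hand side tends to
  \<open>\<kappa> * (norm (N w))\<^sup>2\<close>.\<close>

lemma cocoercive_demiclosed:
  fixes N :: "'a::real_inner \<Rightarrow> 'a"
  assumes N: "cocoercive \<kappa> N" and "0 < \<kappa>"
    and Z: "bounded (range Z)" "weakly_converges_to Z w" "(\<lambda>n. N (Z n)) \<longlonglongrightarrow> 0"
  shows "N w = 0"
proof -
  have "(\<lambda>n. N (Z n) \<bullet> (Z n - w) - N w \<bullet> (Z n - w)) \<longlonglongrightarrow> 0 - 0"
  proof (intro tendsto_diff)
    have "bounded (range (\<lambda>n. Z n - w))"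
      using bounded_translation_minus[OF Z(1), of w] by (simp add: image_image)
    then show "(\<lambda>n. N (Z n) \<bullet> (Z n - w)) \<longlonglongrightarrow> 0"
      by (subst inner_commute) (intro tendsto_inner_bounded_zero Z(3))
    show "(\<lambda>n. N w \<bullet> (Z n - w)) \<longlonglongrightarrow> 0"
      using tendsto_diff[OF weakly_converges_toD[OF Z(2), of "N w"] tendsto_const[of "w \<bullet> N w"]]
      by (simp add: inner_diff_right inner_commute)
  qed
  moreover have "(\<lambda>n. \<kappa> * (norm (N (Z n) - N w))\<^sup>2) \<longlonglongrightarrow> \<kappa> * (norm (0 - N w))\<^sup>2"
    by (intro tendsto_intros Z(3))
  moreover have "\<kappa> * (norm (N (Z n) - N w))\<^sup>2 \<le> N (Z n) \<bullet> (Z n - w) - N w \<bullet> (Z n - w)" for n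
    using N by (simp add: cocoercive_def flip: inner_diff_left)
  ultimately have "\<kappa> * (norm (0 - N w))\<^sup>2 \<le> 0 - 0"
    by (intro LIMSEQ_le) auto
  with \<open>0 < \<kappa>\<close> show ?thesis
    by (simp add: mult_le_0_iff)
qed

text \<open>Here \<open>N\<close> stands for \<open>I - T\<close>, with cocoercivity expressing that
  \<open>T\<close> is averaged. The summands in \<open>diverges\<close> are the descent coefficients
  of \<open>fejer\<close>.\<close>

locale krasnoselskii_mann =
  fixes N :: "'a::{real_inner, complete_space} \<Rightarrow> 'a"
    and \<kappa> :: real and l :: "nat \<Rightarrow> real" and z :: "nat \<Rightarrow> 'a" and p :: 'a
  assumes coco: "cocoercive \<kappa> N" and pos: "0 < \<kappa>"
    and l: "\<And>k. 0 < l k" "\<And>k. l k < 2 * \<kappa>"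
    and diverges: "filterlim (\<lambda>n. \<Sum>k<n. l k * (2 * \<kappa> - l k)) at_top sequentially"
    and step: "\<And>k. z (Suc k) = z k - l k *\<^sub>R N (z k)"
    and zero: "N p = 0"
begin

lemma cocoD: "\<kappa> * (norm (N x - N y))\<^sup>2 \<le> (N x - N y) \<bullet> (x - y)"
  using coco by (simp add: cocoercive_def)

lemma weight_pos: "0 < l k * (2 * \<kappa> - l k)"
  using l[of k] by simp

text \<open>After expanding the square, cocoercivity between \<open>z k\<close> and the zero
  \<open>q\<close> bounds the cross term.\<close>

lemma fejer:
  assumes "N q = 0"
  shows "(norm (z (Suc k) - q))\<^sup>2 \<le> (norm (z k - q))\<^sup>2 - l k * (2 * \<kappa> - l k) * (norm (N (z k)))\<^sup>2"
proof -
  have "(norm (z (Suc k) - q))\<^sup>2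
      = (norm (z k - q))\<^sup>2 - 2 * l k * (N (z k) \<bullet> (z k - q)) + (l k)\<^sup>2 * (norm (N (z k)))\<^sup>2"
    unfolding step power2_norm_eq_inner
    by (simp add: algebra_simps inner_commute power2_eq_square)
  also have "\<dots> \<le> (norm (z k - q))\<^sup>2 - 2 * l k * (\<kappa> * (norm (N (z k)))\<^sup>2)
      + (l k)\<^sup>2 * (norm (N (z k)))\<^sup>2"
    using cocoD[of "z k" q] assms l(1)[of k] by simp
  finally show ?thesis
    by (simp add: algebra_simps power2_eq_square)
qed

lemma fejer_decseq:
  assumes "N q = 0"
  shows "decseq (\<lambda>k. (norm (z k - q))\<^sup>2)"
proof (rule decseq_SucI)
  fix k
  have "0 \<le> l k * (2 * \<kappa> - l k) * (norm (N (z k)))\<^sup>2"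
    using weight_pos[of k] by simp
  with fejer[OF assms, of k] show "(norm (z (Suc k) - q))\<^sup>2 \<le> (norm (z k - q))\<^sup>2"
    by linarith
qed

lemma fejer_convergent:
  assumes "N q = 0"
  shows "convergent (\<lambda>k. (norm (z k - q))\<^sup>2)"
  by (rule decseq_convergent[OF fejer_decseq[OF assms], of 0]) (auto simp: convergent_def)

lemma bounded_z: "bounded (range z)"
proof -
  have "norm (z k) \<le> norm (z 0 - p) + norm p" for k
  proof -
    have "norm (z k - p) \<le> norm (z 0 - p)"
      by (rule power2_le_imp_le[OF decseqD[OF fejer_decseq[OF zero]]]) simp_all
    then show ?thesis
      using norm_triangle_sub[of "z k" p] by linarith
  qed
  then show ?thesis by (auto simp: bounded_iff)
qed

text \<open>Consecutive iterates differ by \<open>- l k *\<^sub>R N (z k)\<close>, so cocoercivity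
  between them together with \<open>l k < 2 * \<kappa>\<close> gives the decrease. Divergence of the
  weights would by itself only make a subsequence of the residuals vanish.\<close>

lemma residual_decseq: "decseq (\<lambda>k. (norm (N (z k)))\<^sup>2)"
proof (rule decseq_SucI)
  fix k
  define s where "s = N (z (Suc k)) - N (z k)"
  have "\<kappa> * (norm s)\<^sup>2 \<le> - (l k * (N (z k) \<bullet> s))"
    using cocoD[of "z (Suc k)" "z k"] by (simp add: s_def step inner_commute)
  moreover have "l k / 2 * (norm s)\<^sup>2 \<le> \<kappa> * (norm s)\<^sup>2"
    using l(2)[of k] by (intro mult_right_mono) auto
  ultimately have "l k * ((norm s)\<^sup>2 + 2 * (N (z k) \<bullet> s)) \<le> 0"
    by (simp add: algebra_simps)
  then have "(norm s)\<^sup>2 + 2 * (N (z k) \<bullet> s) \<le> 0"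
    using l(1)[of k] by (simp add: mult_le_0_iff)
  moreover have "(norm (N (z (Suc k))))\<^sup>2 = (norm (N (z k)))\<^sup>2 + 2 * (N (z k) \<bullet> s) + (norm s)\<^sup>2"
    by (simp add: s_def power2_norm_eq_inner algebra_simps inner_commute)
  ultimately show "(norm (N (z (Suc k))))\<^sup>2 \<le> (norm (N (z k)))\<^sup>2"
    by simp
qed

text \<open>Summing \<open>fejer\<close> bounds the weighted sum of squared residuals. Since the
  residuals decrease, the last one times the total weight \<open>w n\<close> obeys the same bound,
  while \<open>w n\<close> tends to infinity.\<close>

lemma residual_tendsto: "(\<lambda>k. N (z k)) \<longlonglongrightarrow> 0"
proof -
  define w where "w n = (\<Sum>k<n. l k * (2 * \<kappa> - l k))" for n
  have telescope: "(\<Sum>k<n. l k * (2 * \<kappa> - l k) * (norm (N (z k)))\<^sup>2) + (norm (z n - p))\<^sup>2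
      \<le> (norm (z 0 - p))\<^sup>2" for n
  proof (induction n)
    case (Suc n)
    then show ?case using fejer[OF zero, of n] by simp
  qed simp
  have bound: "w n * (norm (N (z n)))\<^sup>2 \<le> (norm (z 0 - p))\<^sup>2" for n
  proof -
    have "w n * (norm (N (z n)))\<^sup>2 \<le> (\<Sum>k<n. l k * (2 * \<kappa> - l k) * (norm (N (z k)))\<^sup>2)"
      unfolding w_def sum_distrib_right
      using weight_pos less_imp_le decseqD[OF residual_decseq]
      by (intro sum_mono mult_left_mono) auto
    also have "\<dots> \<le> (norm (z 0 - p))\<^sup>2"
      using telescope[of n] by (smt (verit) zero_le_power2)
    finally show ?thesis .
  qed
  have w: "filterlim w at_top sequentially"
    using diverges unfolding w_def .
  have "(\<lambda>n. (norm (N (z n)))\<^sup>2) \<longlonglongrightarrow> 0"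
  proof (rule tendsto_sandwich[OF _ _ tendsto_const])
    show "\<forall>\<^sub>F n in sequentially. (norm (N (z n)))\<^sup>2 \<le> (norm (z 0 - p))\<^sup>2 / w n"
      using filterlim_at_top_dense[THEN iffD1, OF w, rule_format, of 0]
    proof eventually_elim
      case (elim n)
      with bound[of n] show ?case
        by (simp add: field_simps)
    qed
    show "(\<lambda>n. (norm (z 0 - p))\<^sup>2 / w n) \<longlonglongrightarrow> 0"
      by (intro real_tendsto_divide_at_top[OF tendsto_const] w)
  qed auto
  then have "(\<lambda>n. sqrt ((norm (N (z n)))\<^sup>2)) \<longlonglongrightarrow> sqrt 0"
    by (rule tendsto_real_sqrt)
  then show ?thesis
    by (simp add: tendsto_norm_zero_iff)
qed

lemma cluster_zero:
  assumes "strict_mono r" "weakly_converges_to (z \<circ> r) w"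
  shows "N w = 0"
proof (rule cocoercive_demiclosed[OF coco pos _ assms(2)])
  show "bounded (range (z \<circ> r))"
    by (rule bounded_subset[OF bounded_z]) auto
  show "(\<lambda>n. N ((z \<circ> r) n)) \<longlonglongrightarrow> 0"
    using LIMSEQ_subseq_LIMSEQ[OF residual_tendsto assms(1)] by (simp add: comp_def)
qed

text \<open>Opial's argument: \<open>norm (z k - q) ^ 2 - norm (z k - q') ^ 2\<close> is affine in \<open>z k\<close>
  and convergent, so it takes the same value at the two cluster points.\<close>

lemma cluster_unique:
  assumes "strict_mono r" "weakly_converges_to (z \<circ> r) q"
    and "strict_mono r'" "weakly_converges_to (z \<circ> r') q'"
  shows "q = q'"
proof -
  have "N q = 0" "N q' = 0"
    using assms cluster_zero by blast+
  define f where "f k = (norm (z k - q'))\<^sup>2 - (norm (z k - q))\<^sup>2" for k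
  have "convergent f"
    unfolding f_def by (intro convergent_diff fejer_convergent) fact+
  then obtain c where c: "f \<longlonglongrightarrow> c" by (auto simp: convergent_def)
  have f: "f k = 2 * (z k \<bullet> (q - q')) + (q' \<bullet> q' - q \<bullet> q)" for k
    by (simp add: f_def power2_norm_eq_inner algebra_simps inner_commute)
  have lim: "c = 2 * (x \<bullet> (q - q')) + (q' \<bullet> q' - q \<bullet> q)"
    if "strict_mono s" "weakly_converges_to (z \<circ> s) x" for s x
  proof (rule LIMSEQ_unique)
    show "(f \<circ> s) \<longlonglongrightarrow> c"
      using LIMSEQ_subseq_LIMSEQ[OF c that(1)] .
    show "(f \<circ> s) \<longlonglongrightarrow> 2 * (x \<bullet> (q - q')) + (q' \<bullet> q' - q \<bullet> q)"
      using weakly_converges_toD[OF that(2), of "q - q'"] unfolding comp_def f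
      by (intro tendsto_add tendsto_mult tendsto_const)
  qed
  have "(q - q') \<bullet> (q - q') = 0"
    using lim[OF assms(1,2)] lim[OF assms(3,4)] by (simp add: inner_diff_left)
  then show ?thesis by simp
qed

theorem weak_convergence:
  obtains w where "N w = 0" "weakly_converges_to z w"
proof -
  obtain w r where r: "strict_mono r" "weakly_converges_to (z \<circ> r) w"
    using bounded_imp_weakly_convergent_subseq[OF bounded_z] by blast
  have "weakly_converges_to z w"
    using bounded_z cluster_unique[OF _ _ r] by (rule bounded_weakly_converges_toI)
  with cluster_zero[OF r] that show thesis by blast
qed

end


section \<open>The three-operator splitting\<close>

locale three_operators =
  fixes A B :: "'a::{real_inner, complete_space} \<Rightarrow> 'a set" and C :: "'a \<Rightarrow> 'a" and \<beta> \<gamma> :: real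
  assumes A: "maximal_monotone A" and B: "maximal_monotone B"
    and C: "cocoercive \<beta> C" and \<beta>: "0 < \<beta>" and \<gamma>: "0 < \<gamma>"
begin

definition JB where "JB w = resolvent (scale_op \<gamma> B) w"
definition fwd where "fwd w = 2 *\<^sub>R JB w - w - \<gamma> *\<^sub>R C (JB w)"
definition JA where "JA w = resolvent (scale_op \<gamma> A) (fwd w)"
text \<open>This is the displacement \<open>I - T\<close>; the forward step is already absorbed into
  \<open>JA\<close>.\<close>

definition N where "N w = JB w - JA w"

lemma JB_mem: "w - JB w \<in> scale_op \<gamma> B (JB w)"
  unfolding JB_def by (intro resolvent_mem maximal_monotone_scale_op B \<gamma>)

lemma JA_mem: "fwd w - JA w \<in> scale_op \<gamma> A (JA w)"
  unfolding JA_def by (intro resolvent_mem maximal_monotone_scale_op A \<gamma>)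

lemma JB_mono: "0 \<le> ((z - JB z) - (w - JB w)) \<bullet> (JB z - JB w)"
  by (intro maximal_monotoneD[OF maximal_monotone_scale_op[OF B \<gamma>]] JB_mem)

lemma JA_mono: "0 \<le> ((fwd z - JA z) - (fwd w - JA w)) \<bullet> (JA z - JA w)"
  by (intro maximal_monotoneD[OF maximal_monotone_scale_op[OF A \<gamma>]] JA_mem)

lemma C_mono: "\<beta> * (norm (C x - C y))\<^sup>2 \<le> (C x - C y) \<bullet> (x - y)"
  using C by (simp add: cocoercive_def)

text \<open>The monotonicity of \<open>B\<close> and \<open>\<gamma>\<close> times the cocoercivity
  of \<open>C\<close> are added to the pairing for \<open>A\<close>. That pairing and the norm of
  the \<open>C\<close> difference are kept on the left because both must later be shown to vanish in
  the limit.\<close>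

lemma monotonicity_sum:
  "((fwd z - JA z) - (fwd w - JA w)) \<bullet> (JA z - JA w) + \<gamma> * \<beta> * (norm (C (JB z) - C (JB w)))\<^sup>2
    \<le> (N z - N w) \<bullet> (z - w) - (norm (N z - N w))\<^sup>2 + \<gamma> * ((N z - N w) \<bullet> (C (JB z) - C (JB w)))"
proof -
  define a b c d where "a = JA z - JA w" and "b = JB z - JB w" and "c = C (JB z) - C (JB w)"
    and "d = z - w"
  have dA: "(fwd z - JA z) - (fwd w - JA w) = 2 *\<^sub>R b - d - \<gamma> *\<^sub>R c - a"
    by (simp add: fwd_def a_def b_def c_def d_def algebra_simps)
  have N: "N z - N w = b - a"
    by (simp add: N_def a_def b_def)
  have "0 \<le> (d - b) \<bullet> b"
    using JB_mono[of z w] by (simp add: b_def d_def algebra_simps)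
  moreover have "\<gamma> * (\<beta> * (norm c)\<^sup>2) \<le> \<gamma> * (c \<bullet> b)"
    using C_mono[of "JB z" "JB w"] \<gamma> by (intro mult_left_mono) (auto simp: b_def c_def)
  moreover have "(2 *\<^sub>R b - d - \<gamma> *\<^sub>R c - a) \<bullet> a + (d - b) \<bullet> b + \<gamma> * (c \<bullet> b)
      = (b - a) \<bullet> d - (norm (b - a))\<^sup>2 + \<gamma> * ((b - a) \<bullet> c)"
    by (simp add: power2_norm_eq_inner algebra_simps inner_commute)
  ultimately show ?thesis
    unfolding dA N a_def[symmetric] c_def[symmetric] d_def[symmetric] by simp
qed

lemma N_cocoercive: "cocoercive (1 - \<gamma> / (4 * \<beta>)) N"
  unfolding cocoercive_def
proof (intro allI)
  fix z w
  define n c where "n = N z - N w" and "c = C (JB z) - C (JB w)"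
  \<comment> \<open>The factor \<open>1 / (2 * \<beta>)\<close> completes the square so that the
    \<open>c\<close> term of \<open>monotonicity_sum\<close> cancels; the remaining multiple of the
    squared norm of \<open>n\<close> is the loss in the constant.\<close>
  have "0 \<le> \<gamma> * \<beta> * ((c - (1 / (2 * \<beta>)) *\<^sub>R n) \<bullet> (c - (1 / (2 * \<beta>)) *\<^sub>R n))"
    using \<beta> \<gamma> by simp
  also have "\<dots> = \<gamma> * \<beta> * (norm c)\<^sup>2 - \<gamma> * (n \<bullet> c) + \<gamma> / (4 * \<beta>) * (norm n)\<^sup>2"
    unfolding power2_norm_eq_inner using \<beta>
    by (simp add: inner_diff_left inner_diff_right inner_commute field_simps)
  finally have "0 \<le> \<gamma> * \<beta> * (norm c)\<^sup>2 - \<gamma> * (n \<bullet> c) + \<gamma> / (4 * \<beta>) * (norm n)\<^sup>2" .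
  then show "(1 - \<gamma> / (4 * \<beta>)) * (norm (N z - N w))\<^sup>2 \<le> (N z - N w) \<bullet> (z - w)"
    using monotonicity_sum[of z w] JA_mono[of z w]
    by (simp add: n_def c_def algebra_simps)
qed

lemma JB_nonexpansive: "norm (JB z - JB w) \<le> norm (z - w)"
proof -
  have "norm (JB z - JB w) * norm (JB z - JB w) \<le> (z - w) \<bullet> (JB z - JB w)"
    using JB_mono[of z w]
    by (simp add: norm_eq_square[symmetric] power2_eq_square[symmetric] power2_norm_eq_inner inner_diff_left)
  also have "\<dots> \<le> norm (z - w) * norm (JB z - JB w)"
    by (rule norm_cauchy_schwarz)
  finally show ?thesis
    by (cases "norm (JB z - JB w) = 0") (auto simp: mult_le_cancel_right)
qed

lemma C_lipschitz: "\<beta> * norm (C x - C y) \<le> norm (x - y)"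
proof -
  have "\<beta> * norm (C x - C y) * norm (C x - C y) \<le> norm (x - y) * norm (C x - C y)"
    using C_mono[of x y] norm_cauchy_schwarz[of "C x - C y" "x - y"]
    by (simp add: power2_eq_square mult_ac)
  then show ?thesis
    by (cases "norm (C x - C y) = 0") (auto simp: mult_le_cancel_right)
qed

text \<open>At a zero of \<open>N\<close> both resolvents give the same point; the elements of
  \<open>A\<close> and \<open>B\<close> that they supply there add up to
  \<open>- C (JB w)\<close>.\<close>

lemma zero_of_sum:
  assumes "N w = 0"
  shows "JB w \<in> zer (plus_op (plus_op A B) (single_valued_op C))"
proof -
  let ?x = "JB w"
  have "JA w = ?x" using assms by (simp add: N_def)
  then have a: "(fwd w - ?x) /\<^sub>R \<gamma> \<in> A ?x" and b: "(w - ?x) /\<^sub>R \<gamma> \<in> B ?x"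
    using JA_mem[of w] JB_mem[of w] \<gamma> by (auto simp: mem_scale_op_iff)
  have "(fwd w - ?x) /\<^sub>R \<gamma> + (w - ?x) /\<^sub>R \<gamma> + C ?x = 0"
    using \<gamma> by (simp add: fwd_def algebra_simps scaleR_2)
  with a b show ?thesis
    unfolding zer_def plus_op_def single_valued_op_def by force
qed

section \<open>Weak limits of the two resolvent sequences\<close>

context
  fixes z :: "nat \<Rightarrow> 'a" and w :: 'a
  assumes z_bounded: "bounded (range z)" and z_weak: "weakly_converges_to z w"
    and N_z: "(\<lambda>k. N (z k)) \<longlonglongrightarrow> 0" and N_w: "N w = 0"
begin

lemma bounded_differences:
  "bounded (range (\<lambda>k. z k - w))" "bounded (range (\<lambda>k. JB (z k) - JB w))"
  "bounded (range (\<lambda>k. C (JB (z k)) - C (JB w)))"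
proof -
  obtain M where "\<And>k. norm (z k) \<le> M"
    using z_bounded by (auto simp: bounded_iff)
  then have M: "norm (z k - w) \<le> M + norm w" for k
    by (meson add_right_mono norm_triangle_ineq4 order_trans)
  then show "bounded (range (\<lambda>k. z k - w))"
    by (auto simp: bounded_iff)
  have M': "norm (JB (z k) - JB w) \<le> M + norm w" for k
    using JB_nonexpansive M order_trans by blast
  then show "bounded (range (\<lambda>k. JB (z k) - JB w))"
    by (auto simp: bounded_iff)
  have "norm (C (JB (z k)) - C (JB w)) \<le> (M + norm w) / \<beta>" for k
    using order_trans[OF C_lipschitz M'] \<beta> by (simp add: field_simps)
  then show "bounded (range (\<lambda>k. C (JB (z k)) - C (JB w)))"
    by (auto simp: bounded_iff)
qed

text \<open>The right-hand side of \<open>monotonicity_sum\<close> pairs the vanishing residuals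
  with bounded sequences, so it tends to 0, and it dominates two nonnegative terms.\<close>

lemma monotonicity_gaps_tendsto:
  "(\<lambda>k. ((fwd (z k) - JA (z k)) - (fwd w - JA w)) \<bullet> (JA (z k) - JA w)) \<longlonglongrightarrow> 0"
  "(\<lambda>k. C (JB (z k)) - C (JB w)) \<longlonglongrightarrow> 0"
proof -
  define g where "g k = ((fwd (z k) - JA (z k)) - (fwd w - JA w)) \<bullet> (JA (z k) - JA w)" for k
  define c where "c k = C (JB (z k)) - C (JB w)" for k
  define h where "h k = N (z k) \<bullet> (z k - w) - (norm (N (z k)))\<^sup>2 + \<gamma> * (N (z k) \<bullet> c k)" for k
  have "h \<longlonglongrightarrow> 0 - (norm (0::'a))\<^sup>2 + \<gamma> * 0"
    unfolding h_def c_def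
    using tendsto_inner_bounded_zero[OF bounded_differences(1) N_z]
      tendsto_inner_bounded_zero[OF bounded_differences(3) N_z]
    by (intro tendsto_intros N_z) (simp_all add: inner_commute)
  then have h: "h \<longlonglongrightarrow> 0" by simp
  have le: "g k + \<gamma> * \<beta> * (norm (c k))\<^sup>2 \<le> h k" for k
    using monotonicity_sum[of "z k" w] N_w by (simp add: g_def h_def c_def)
  have g0: "0 \<le> g k" for k
    unfolding g_def by (rule JA_mono)
  have c0: "0 \<le> \<gamma> * \<beta> * (norm (c k))\<^sup>2" for k
    using \<beta> \<gamma> by simp
  have "g \<longlonglongrightarrow> 0"
    using le g0 c0 by (intro tendsto_sandwich[OF _ _ tendsto_const h] always_eventually allI)
      (auto intro: order_trans[rotated, OF le])
  then show "(\<lambda>k. ((fwd (z k) - JA (z k)) - (fwd w - JA w)) \<bullet> (JA (z k) - JA w)) \<longlonglongrightarrow> 0"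
    by (simp add: g_def[abs_def])
  have "(\<lambda>k. \<gamma> * \<beta> * (norm (c k))\<^sup>2) \<longlonglongrightarrow> 0"
    using le g0 c0 by (intro tendsto_sandwich[OF _ _ tendsto_const h] always_eventually allI)
      (auto intro: order_trans[rotated, OF le])
  from tendsto_real_sqrt[OF tendsto_divide[OF this tendsto_const, of "\<gamma> * \<beta>"]]
  have "(\<lambda>k. norm (c k)) \<longlonglongrightarrow> 0"
    using \<beta> \<gamma> by simp
  then show "(\<lambda>k. C (JB (z k)) - C (JB w)) \<longlonglongrightarrow> 0"
    by (simp add: c_def tendsto_norm_zero_iff)
qed

text \<open>If \<open>JB w + h\<close> is a weak cluster point of \<open>JB (z k)\<close>, then \<open>JB w + h\<close> and
  \<open>fwd w - JA w + h\<close> are weak cluster points of the two components of points in the graph of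
  \<open>scale_op \<gamma> A\<close>. Passing to the limit in the monotonicity inequality shows that this pair is
  related to the graph with a surplus of \<open>h \<bullet> h\<close>, so it belongs to the graph and \<open>h = 0\<close>.\<close>

lemma JB_cluster:
  assumes r: "strict_mono r" and x: "weakly_converges_to ((\<lambda>k. JB (z k)) \<circ> r) x"
  shows "x = JB w"
proof -
  define h where "h = x - JB w"
  define a where "a = fwd w - JA w"
  have JA_w: "JA w = JB w" using N_w by (simp add: N_def)
  have sub: "(\<lambda>k. f (r k)) \<longlonglongrightarrow> L" if "f \<longlonglongrightarrow> L" for f and L :: "'b::topological_space"
    using LIMSEQ_subseq_LIMSEQ[OF that r] by (simp add: comp_def)
  have wb: "weakly_converges_to (\<lambda>k. JB (z (r k)) - JB w) h"
    unfolding h_def using x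
    by (intro weakly_converges_to_diff tendsto_imp_weakly_converges_to[of "\<lambda>_. JB w"])
      (simp_all add: comp_def)
  have wN: "weakly_converges_to (\<lambda>k. N (z (r k))) 0"
    by (intro tendsto_imp_weakly_converges_to sub[OF N_z])
  have wa: "weakly_converges_to (\<lambda>k. JA (z (r k)) - JA w) h"
    using weakly_converges_to_diff[OF wb wN] by (simp add: N_def JA_w)
  have wc: "weakly_converges_to (\<lambda>k. \<gamma> *\<^sub>R (C (JB (z (r k))) - C (JB w))) 0"
    using tendsto_scaleR[OF tendsto_const sub[OF monotonicity_gaps_tendsto(2)], of \<gamma>]
    by (intro tendsto_imp_weakly_converges_to) simp
  have wd: "weakly_converges_to (\<lambda>k. z (r k) - w) 0"
    using weakly_converges_to_diff[OF weakly_converges_to_subseq[OF z_weak r]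
        tendsto_imp_weakly_converges_to[OF tendsto_const], of w] by (simp add: comp_def)
  \<comment> \<open>The sequence is the \<open>JB\<close> difference plus the residual, minus the
    \<open>z\<close> difference and the \<open>C\<close> term; all but the first converge weakly to
    0.\<close>
  have wA: "weakly_converges_to (\<lambda>k. (fwd (z (r k)) - JA (z (r k))) - a) h"
    using weakly_converges_to_diff[OF weakly_converges_to_diff[OF
          weakly_converges_to_add[OF wb wN] wd] wc]
    by (simp add: a_def fwd_def N_def JA_w algebra_simps scaleR_2)
  have key: "h \<bullet> h \<le> ((a + h) - v) \<bullet> ((JB w + h) - y)" if v: "v \<in> scale_op \<gamma> A y" for y v
  proof -
    let ?u = "\<lambda>k. (fwd (z (r k)) - JA (z (r k))) - a" and ?d = "\<lambda>k. JA (z (r k)) - JA w"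
    \<comment> \<open>Weak convergence does not control the product of \<open>?u\<close> and
      \<open>?d\<close>, but this is the gap of \<open>A\<close>, which tends to 0. Its limit being
      0 instead of \<open>h \<bullet> h\<close> is the source of the surplus.\<close>
    have "(\<lambda>k. ?u k \<bullet> ?d k + ?d k \<bullet> (a - v) + ?u k \<bullet> (JA w - y) + (a - v) \<bullet> (JA w - y))
        \<longlonglongrightarrow> 0 + h \<bullet> (a - v) + h \<bullet> (JA w - y) + (a - v) \<bullet> (JA w - y)"
      unfolding a_def
      by (intro tendsto_add tendsto_const sub[OF monotonicity_gaps_tendsto(1)]
          weakly_converges_toD[OF wa] weakly_converges_toD[OF wA[unfolded a_def]])
    moreover have "0 \<le> ?u k \<bullet> ?d k + ?d k \<bullet> (a - v) + ?u k \<bullet> (JA w - y) + (a - v) \<bullet> (JA w - y)" for k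
      using maximal_monotoneD[OF maximal_monotone_scale_op[OF A \<gamma>] JA_mem v, of "z (r k)"]
      by (simp add: algebra_simps inner_commute)
    ultimately have "0 \<le> 0 + h \<bullet> (a - v) + h \<bullet> (JA w - y) + (a - v) \<bullet> (JA w - y)"
      by (intro LIMSEQ_le_const) auto
    then show ?thesis
      by (simp add: JA_w algebra_simps inner_commute)
  qed
  have "a + h \<in> scale_op \<gamma> A (JB w + h)"
    by (rule maximal_monotone_memI[OF maximal_monotone_scale_op[OF A \<gamma>]])
      (use key inner_ge_zero order_trans in blast)
  from key[OF this] have "h \<bullet> h = 0"
    using inner_ge_zero[of h] by simp
  then have "h = 0" by simp
  then show ?thesis by (simp add: h_def)
qed

lemma JB_weak: "weakly_converges_to (\<lambda>k. JB (z k)) (JB w)"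
proof (rule bounded_weakly_converges_toI)
  obtain M where M: "\<And>k. norm (JB (z k) - JB w) \<le> M"
    using bounded_differences(2) by (auto simp: bounded_iff)
  have "norm (JB (z k)) \<le> M + norm (JB w)" for k
    using norm_triangle_sub[of "JB (z k)" "JB w"] M[of k] by simp
  then show "bounded (range (\<lambda>k. JB (z k)))"
    by (auto simp: bounded_iff)
qed (rule JB_cluster)

lemma JA_weak: "weakly_converges_to (\<lambda>k. JA (z k)) (JB w)"
  using weakly_converges_to_diff[OF JB_weak tendsto_imp_weakly_converges_to[OF N_z]]
  by (simp add: N_def)

end

end

text \<open>Both factors of \<open>(1 / \<alpha> - \<mu> j) * \<mu> j\<close> are at least
  \<open>\<epsilon>\<close>, so the partial sums grow at least linearly.\<close>

lemma relaxation_sum_diverges_away: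
  assumes "0 < \<alpha>" "0 < \<epsilon>" and \<mu>: "\<And>j. \<epsilon> \<le> \<mu> j" "\<And>j. \<mu> j \<le> 1 / \<alpha> - \<epsilon>"
  shows "relaxation_sum_diverges \<alpha> \<mu>"
  unfolding relaxation_sum_diverges_def
proof (rule filterlim_at_top_mono)
  show "filterlim (\<lambda>n. \<epsilon> * \<epsilon> * real n) at_top sequentially"
    using \<open>0 < \<epsilon>\<close> by (intro filterlim_tendsto_pos_mult_at_top[OF tendsto_const] filterlim_real_sequentially) simp
  have "\<epsilon> * \<epsilon> \<le> (1 - \<alpha> * \<mu> j) * \<mu> j / \<alpha>" for j
  proof -
    have "\<epsilon> * \<epsilon> \<le> (1 / \<alpha> - \<mu> j) * \<mu> j"
      using \<mu>[of j] \<open>0 < \<epsilon>\<close> by (intro mult_mono) auto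
    then show ?thesis
      using \<open>0 < \<alpha>\<close> by (simp add: field_simps)
  qed
  then have "real n * (\<epsilon> * \<epsilon>) \<le> (\<Sum>j<n. (1 - \<alpha> * \<mu> j) * \<mu> j / \<alpha>)" for n
    using sum_bounded_below[of "{..<n}" "\<epsilon> * \<epsilon>"] by simp
  then show "\<forall>\<^sub>F n in sequentially. \<epsilon> * \<epsilon> * real n \<le> (\<Sum>j<n. (1 - \<alpha> * \<mu> j) * \<mu> j / \<alpha>)"
    by (simp add: mult.commute)
qed

text \<open>The first two conjuncts record the equality of the intervals and the parenthetical
  sufficient condition. A single \<open>x\<close> is the weak limit of both \<open>xB\<close> and
  \<open>xA\<close>; the proof takes \<open>JB w\<close> for the weak limit \<open>w\<close> of
  \<open>z\<close>.\<close>

theorem theorem1p1: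
  fixes A B :: "'a::{real_inner, complete_space} \<Rightarrow> 'a set"
    and C T :: "'a \<Rightarrow> 'a"
    and \<alpha> \<beta> \<gamma> :: real
    and l :: "nat \<Rightarrow> real"
    and z xA xB :: "nat \<Rightarrow> 'a"
  assumes "maximal_monotone A" and "maximal_monotone B"
    and "\<beta> > 0" and "cocoercive \<beta> C"
    and "\<gamma> \<in> {0<..<2 * \<beta>}"
    and "T = (\<lambda>w. w - resolvent (scale_op \<gamma> B) w
               + resolvent (scale_op \<gamma> A)
                   (2 *\<^sub>R resolvent (scale_op \<gamma> B) w - w
                     - \<gamma> *\<^sub>R C (resolvent (scale_op \<gamma> B) w)))"
    and "Fix T \<noteq> {}"
    and "\<alpha> = 2 * \<beta> / (4 * \<beta> - \<gamma>)"
    and "\<And>j. l j \<in> {0<..<(4 * \<beta> - \<gamma>) / (2 * \<beta>)}"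
    and "relaxation_sum_diverges \<alpha> l"
    and "\<And>k. xB k = resolvent (scale_op \<gamma> B) (z k)"
    and "\<And>k. xA k = resolvent (scale_op \<gamma> A) (2 *\<^sub>R xB k - z k - \<gamma> *\<^sub>R C (xB k))"
    and "\<And>k. z (Suc k) = z k + l k *\<^sub>R (xA k - xB k)"
  shows "{0<..<(4 * \<beta> - \<gamma>) / (2 * \<beta>)} = {0<..<1 / \<alpha>}
    \<and> (\<forall>\<mu>. (\<exists>\<epsilon>>0. \<forall>j. \<epsilon> \<le> \<mu> j \<and> \<mu> j \<le> 1 / \<alpha> - \<epsilon>) \<longrightarrow> relaxation_sum_diverges \<alpha> \<mu>)
    \<and> (\<exists>w\<in>Fix T. weakly_converges_to z w)
    \<and> (\<exists>x\<in>zer (plus_op (plus_op A B) (single_valued_op C)).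
          weakly_converges_to xB x \<and> weakly_converges_to xA x)"
proof -
  have \<gamma>: "0 < \<gamma>" "\<gamma> < 2 * \<beta>"
    using assms(5) by auto
  have \<alpha>: "0 < \<alpha>" "1 / \<alpha> = (4 * \<beta> - \<gamma>) / (2 * \<beta>)"
    using assms(8) \<gamma> \<open>\<beta> > 0\<close> by auto
  interpret three_operators A B C \<beta> \<gamma>
    by unfold_locales (use assms \<gamma> in auto)
  have xB: "xB = (\<lambda>k. JB (z k))" and xA: "xA = (\<lambda>k. JA (z k))"
    using assms(11,12) by (simp_all add: fun_eq_iff JB_def JA_def fwd_def)
  have T: "T w = w - N w" for w
    by (simp add: assms(6) N_def JB_def JA_def fwd_def)
  have Fix: "w \<in> Fix T \<longleftrightarrow> N w = 0" for w
    by (simp add: Fix_def T)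
  \<comment> \<open>This cocoercivity constant equals \<open>1 / (2 * \<alpha>)\<close>, so the
    range of \<open>l\<close> and the divergent sum take the form required by
    \<open>krasnoselskii_mann\<close>.\<close>
  define \<kappa> where "\<kappa> = 1 - \<gamma> / (4 * \<beta>)"
  have \<kappa>: "2 * \<kappa> = 1 / \<alpha>"
    unfolding \<kappa>_def \<alpha>(2) using \<open>\<beta> > 0\<close> by (simp add: field_simps)
  obtain p where "N p = 0"
    using assms(7) Fix by auto
  interpret krasnoselskii_mann N \<kappa> l z p
  proof
    show "cocoercive \<kappa> N"
      unfolding \<kappa>_def by (rule N_cocoercive)
    show "0 < \<kappa>"
      using \<kappa> \<alpha>(1) by (metis zero_less_divide_1_iff zero_less_mult_pos zero_less_numeral)
    show "0 < l k" "l k < 2 * \<kappa>" for k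
      using assms(9)[of k] unfolding \<kappa> \<alpha>(2) by auto
    have "l k * (2 * \<kappa> - l k) = (1 - \<alpha> * l k) * l k / \<alpha>" for k
      unfolding \<kappa> using \<alpha>(1) by (simp add: field_simps)
    then show "filterlim (\<lambda>n. \<Sum>k<n. l k * (2 * \<kappa> - l k)) at_top sequentially"
      using assms(10) by (simp add: relaxation_sum_diverges_def)
    show "z (Suc k) = z k - l k *\<^sub>R N (z k)" for k
      using assms(13)[of k] by (simp add: xA xB N_def algebra_simps)
  qed fact
  obtain w where w: "N w = 0" "weakly_converges_to z w"
    by (rule weak_convergence)
  note limit = bounded_z w(2) residual_tendsto w(1)
  show ?thesis
    using \<alpha> Fix w relaxation_sum_diverges_away[OF \<alpha>(1)] zero_of_sum[OF w(1)]
      JB_weak[OF limit] JA_weak[OF limit]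
    unfolding xA xB by auto
qed

end
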